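(* Let $\gamma\in[0,1)$, $p_0,p_1\in[0,1]$, $b\in\mathbb{R}$, and let $(\mathbf{d}(0),\mathbf{d}(1))$ be a probability vector. Put $\mathbf{d}^\gamma_s=(1-\gamma)\mathbf{d}(s)$ for $s\in\{0,1\}$. Consider the functional optimization problem $\mathbf{P1}$ and the four-variable optimization problem $\mathbf{P2}$ defined in the context. Then $\mathbf{P1}$ and $\mathbf{P2}$ are equivalent: they have the same optimal value, and whenever $(a_0,a_1,d_0,d_1)$ is an optimal solution of $\mathbf{P2}$, the pair of measures $d(s,\cdot)=d_s\,\delta_{a_s}$, $s\in\{0,1\}$ (with $\delta_a$ the Dirac mass at $a$), is an optimal solution of $\mathbf{P1}$.
   Context: This is a two-state constrained Markov decision process with states $\{0,1\}$, action set $[0,1]$ (action $a$ moves to state $0$ with probability $a$ and to state $1$ with probability $1-a$, whatever the current state), discount factor $\gamma$, initial distribution $\mathbf{d}$, reward $H(a)$ and cost $\mathrm{TV}_s(a)$. Notation: $H(a)=-a\log a-(1-a)\log(1-a)$ is the binary entropy function (with $0\log 0=0$), and $\mathrm{TV}_s(a)=|a-p_s|+|(1-a)-(1-p_s)|=2|a-p_s|$. Problem $\mathbf{P1}$. The variables are two finite nonnegative Borel measures $d(0,\cdot),d(1,\cdot)$ on $[0,1]$ (discounted state-action occupancy measures; point masses are allowed, and one writes $d(s,a)\,da$ for integration against $d(s,\cdot)$). Maximize $$\sum_{s=0}^1\int_0^1 H(a)\,d(s,a)\,da$$ subject to $$\int_0^1\Big(d(0,a)-\sum_{s=0}^1\gamma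 a\,d(s,a)\Big)da=\mathbf{d}^\gamma_0,$$ $$\int_0^1\Big(d(1,a)-\sum_{s=0}^1\gamma(1-a)\,d(s,a)\Big)da=\mathbf{d}^\gamma_1,$$ $$\sum_{s=0}^1\int_0^1\mathrm{TV}_s(a)\,d(s,a)\,da\le b .$$ Problem $\mathbf{P2}$. The variables are real numbers $a_0,a_1,d_0,d_1$. Maximize $$d_0H(a_0)+d_1H(a_1)$$ subject to $(1-\gamma a_0)d_0-\gamma a_1d_1=\mathbf{d}^\gamma_0$, $\; d_0+d_1=1$, $\; d_0\mathrm{TV}_0(a_0)+d_1\mathrm{TV}_1(a_1)\le b$, $\; d_0,d_1\ge 0$, $\; 0\le a_0,a_1\le 1$. The optimal value is the supremum of the objective over the feasible set, with the supremum over the empty set equal to $-\infty$. *)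

theory Defs
  imports "HOL-Probability.Probability"
begin

(* Natural logarithm; 0 log 0 = 0 holds because the factor in front of ln vanishes. *)
definition binary_entropy :: "real \<Rightarrow> real" where
  "binary_entropy a = - a * ln a - (1 - a) * ln (1 - a)"

definition TV :: "real \<Rightarrow> real \<Rightarrow> real" where
  "TV p a = \<bar>a - p\<bar> + \<bar>(1 - a) - (1 - p)\<bar>"

lemma TV_eq: "TV p a = 2 * \<bar>a - p\<bar>"
  by (simp add: TV_def)

abbreviation unit_borel :: "real measure" where
  "unit_borel \<equiv> restrict_space borel {0..1}"

definition occupancy_measure :: "real measure \<Rightarrow> bool" where
  "occupancy_measure \<mu> \<longleftrightarrow> sets \<mu> = sets unit_borel \<and> finite_measure \<mu>"

definition weighted_dirac :: "real \<Rightarrow> real \<Rightarrow> real measure" where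
  "weighted_dirac w a = scale_measure (ennreal w) (return unit_borel a)"

(* A point of P1 is the pair of measures (d(0,.), d(1,.)); nu0, nu1 is the initial
   distribution, which enters the constraints scaled by 1 - gamma.  The integral of
   "d(0,a) - (sum over s of gamma a d(s,a))" da is split into one integral per measure. *)
definition P1_feasible ::
  "real \<Rightarrow> real \<Rightarrow> real \<Rightarrow> real \<Rightarrow> real \<Rightarrow> real \<Rightarrow> real measure \<times> real measure \<Rightarrow> bool" where
  "P1_feasible \<gamma> \<nu>0 \<nu>1 p0 p1 b = (\<lambda>(\<mu>0, \<mu>1).
     occupancy_measure \<mu>0 \<and> occupancy_measure \<mu>1 \<and>
     (\<integral>a. 1 \<partial>\<mu>0) - ((\<integral>a. \<gamma> * a \<partial>\<mu>0) + (\<integral>a. \<gamma> * a \<partial>\<mu>1)) = (1 - \<gamma>) * \<nu>0 \<and>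
     (\<integral>a. 1 \<partial>\<mu>1) - ((\<integral>a. \<gamma> * (1 - a) \<partial>\<mu>0) + (\<integral>a. \<gamma> * (1 - a) \<partial>\<mu>1)) = (1 - \<gamma>) * \<nu>1 \<and>
     (\<integral>a. TV p0 a \<partial>\<mu>0) + (\<integral>a. TV p1 a \<partial>\<mu>1) \<le> b)"

definition P1_objective :: "real measure \<times> real measure \<Rightarrow> real" where
  "P1_objective = (\<lambda>(\<mu>0, \<mu>1). (\<integral>a. binary_entropy a \<partial>\<mu>0) + (\<integral>a. binary_entropy a \<partial>\<mu>1))"

(* A point of P2 is the tuple (a0, a1, d0, d1). *)
definition P2_feasible ::
  "real \<Rightarrow> real \<Rightarrow> real \<Rightarrow> real \<Rightarrow> real \<Rightarrow> real \<times> real \<times> real \<times> real \<Rightarrow> bool" where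
  "P2_feasible \<gamma> \<nu>0 p0 p1 b = (\<lambda>(a0, a1, d0, d1).
     (1 - \<gamma> * a0) * d0 - \<gamma> * a1 * d1 = (1 - \<gamma>) * \<nu>0 \<and>
     d0 + d1 = 1 \<and>
     d0 * TV p0 a0 + d1 * TV p1 a1 \<le> b \<and>
     0 \<le> d0 \<and> 0 \<le> d1 \<and>
     0 \<le> a0 \<and> a0 \<le> 1 \<and> 0 \<le> a1 \<and> a1 \<le> 1)"

definition P2_objective :: "real \<times> real \<times> real \<times> real \<Rightarrow> real" where
  "P2_objective = (\<lambda>(a0, a1, d0, d1). d0 * binary_entropy a0 + d1 * binary_entropy a1)"

(* In ereal, the supremum over the empty set is -\<infinity>. *)
definition optimal_value :: "('a \<Rightarrow> real) \<Rightarrow> ('a \<Rightarrow> bool) \<Rightarrow> ereal" where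
  "optimal_value f P = (SUP x\<in>{x. P x}. ereal (f x))"

(* The Bochner integral is 0 on non-integrable functions; the next lemmas show that this
   default value never occurs in P1. *)
lemma occupancy_integrable_bounded:
  fixes f :: "real \<Rightarrow> real"
  assumes \<mu>: "occupancy_measure \<mu>" and f: "f \<in> borel_measurable borel"
    and B: "\<And>x. 0 \<le> x \<Longrightarrow> x \<le> 1 \<Longrightarrow> \<bar>f x\<bar> \<le> B"
  shows "integrable \<mu> f"
proof -
  interpret finite_measure \<mu> using \<mu> by (simp add: occupancy_measure_def)
  have s: "sets \<mu> = sets unit_borel" using \<mu> by (simp add: occupancy_measure_def)
  have sp: "space \<mu> = {0..1}" using sets_eq_imp_space_eq[OF s] by (simp add: space_restrict_space)
  have "f \<in> borel_measurable \<mu>"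
    using measurable_restrict_space1[OF f] measurable_cong_sets[OF s refl] by blast
  then show ?thesis
    by (intro integrable_const_bound[where B = B]) (auto simp: sp B intro!: AE_I2)
qed

lemma occupancy_integrable_linear:
  assumes "occupancy_measure \<mu>"
  shows "integrable \<mu> (\<lambda>a. \<gamma> * a :: real)" "integrable \<mu> (\<lambda>a. \<gamma> * (1 - a) :: real)"
  by (rule occupancy_integrable_bounded[OF assms, where B = "\<bar>\<gamma>\<bar>"];
      simp add: abs_mult mult_left_le)+

lemma occupancy_integrable_TV:
  assumes "occupancy_measure \<mu>"
  shows "integrable \<mu> (TV p)"
  unfolding TV_def
  by (rule occupancy_integrable_bounded[OF assms, where B = "2 + 2 * \<bar>p\<bar>"]) (simp_all)

lemma occupancy_integrable_binary_entropy:
  assumes "occupancy_measure \<mu>"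
  shows "integrable \<mu> binary_entropy"
proof (rule occupancy_integrable_bounded[OF assms, where B = 2])
  show "binary_entropy \<in> borel_measurable borel"
    unfolding binary_entropy_def by measurable
  have *: "\<bar>y * ln y\<bar> \<le> 1" if "0 \<le> y" "y \<le> 1" for y :: real
  proof (cases "y = 0")
    case False
    with that have y: "0 < y" by simp
    have "ln (1 / y) \<le> 1 / y - 1" using y by (intro ln_le_minus_one) simp
    then have "- ln y \<le> 1 / y" using y by (simp add: ln_div)
    then have "y * (- ln y) \<le> y * (1 / y)" using y by (intro mult_left_mono) auto
    moreover have "y * ln y \<le> 0" using y that by (simp add: mult_nonneg_nonpos)
    ultimately show ?thesis using y by simp
  qed simp
  show "\<bar>binary_entropy x\<bar> \<le> 2" if "0 \<le> x" "x \<le> 1" for x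
    using *[of x] *[of "1 - x"] that unfolding binary_entropy_def by linarith
qed

end

theory Submission
  imports Defs
begin

text \<open>Replacing each occupancy measure by a point mass of the same total mass at its barycentre
  preserves the two flow constraints, which are linear in the action. By Jensen's inequality it
  does not increase the cost (convex in the action) and does not decrease the entropy (concave).
  Hence every point of P1 is dominated by a point of P2, while P2 embeds into P1 through point
  masses. The two flow constraints add up to total mass 1.\<close>

text \<open>One term of Gibbs' inequality: \<open>ln t \<le> t - 1\<close> at
  \<open>t = y / x\<close>, multiplied by \<open>x\<close>. The case \<open>x = 0\<close> is
  separate because there the quotient is meaningless and the left side vanishes.\<close>

lemma mult_ln_diff_le:
  fixes x y :: real
  assumes "0 \<le> x" "0 < y"
  shows "x * ln y - x * ln x \<le> y - x"
proof (cases "x = 0")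
  case False
  with assms have x: "0 < x" by simp
  have "x * ln (y / x) \<le> x * (y / x - 1)"
    using x assms by (intro mult_left_mono ln_le_minus_one) auto
  with x assms show ?thesis by (simp add: ln_div right_diff_distrib)
qed (use assms in simp)

text \<open>Gibbs' inequality for two outcomes: the error terms \<open>c - a\<close> and
  \<open>(1 - c) - (1 - a)\<close> cancel. The right side is affine in \<open>a\<close> and touches
  the entropy at \<open>a = c\<close>, so it is the tangent line there, which is what Jensen's
  inequality requires.\<close>

lemma binary_entropy_le_cross_entropy:
  assumes "0 \<le> a" "a \<le> 1" "0 < c" "c < 1"
  shows "binary_entropy a \<le> - a * ln c - (1 - a) * ln (1 - c)"
  using mult_ln_diff_le[of a c] mult_ln_diff_le[of "1 - a" "1 - c"] assms
  unfolding binary_entropy_def by linarith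

lemma space_occupancy:
  assumes "occupancy_measure \<mu>"
  shows "space \<mu> = {0..1}"
  using sets_eq_imp_space_eq[of \<mu> unit_borel] assms
  by (simp add: occupancy_measure_def space_restrict_space)

lemma occupancy_integrable_id:
  assumes "occupancy_measure \<mu>"
  shows "integrable \<mu> (\<lambda>a. a)"
  using occupancy_integrable_linear(1)[OF assms, of 1] by simp

text \<open>At an endpoint the entropy has no tangent of finite slope. Instead, a measure on [0,1]
  whose barycentre is an endpoint is concentrated there, and the entropy is 0 at both
  endpoints.\<close>

lemma integral_binary_entropy_boundary:
  assumes \<mu>: "occupancy_measure \<mu>" and e: "e = 0 \<or> e = 1"
    and m: "(\<integral>a. a \<partial>\<mu>) = measure \<mu> (space \<mu>) * e"
  shows "(\<integral>a. binary_entropy a \<partial>\<mu>) = 0"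
proof -
  interpret finite_measure \<mu> using \<mu> by (simp add: occupancy_measure_def)
  have int: "integrable \<mu> (\<lambda>a. \<bar>a - e\<bar>)"
    using occupancy_integrable_id[OF \<mu>] by auto
  \<comment> \<open>Since \<open>e\<close> is an endpoint, \<open>a - e\<close> has constant sign on
    [0,1], so the absolute value can be moved outside the integral.\<close>
  have "(\<integral>a. \<bar>a - e\<bar> \<partial>\<mu>) = \<bar>(\<integral>a. a - e \<partial>\<mu>)\<bar>"
  proof (cases "e = 0")
    case True
    have "(\<integral>a. \<bar>a - e\<bar> \<partial>\<mu>) = (\<integral>a. a - e \<partial>\<mu>)"
      using True by (intro Bochner_Integration.integral_cong) (auto simp: space_occupancy[OF \<mu>])
    then show ?thesis using m True by simp
  next
    case False
    then have "(\<integral>a. \<bar>a - e\<bar> \<partial>\<mu>) = (\<integral>a. - (a - e) \<partial>\<mu>)"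
      using e by (intro Bochner_Integration.integral_cong) (auto simp: space_occupancy[OF \<mu>])
    then show ?thesis using m occupancy_integrable_id[OF \<mu>] by simp
  qed
  also have "\<dots> = 0"
    using m occupancy_integrable_id[OF \<mu>] by simp
  finally have "AE a in \<mu>. \<bar>a - e\<bar> = 0"
    using integral_nonneg_eq_0_iff_AE[OF int] by simp
  then have "AE a in \<mu>. binary_entropy a = 0"
    by (rule eventually_mono) (use e in \<open>auto simp: binary_entropy_def\<close>)
  then show ?thesis by (rule integral_eq_zero_AE)
qed

text \<open>The product form of the equation also covers the zero measure, which has no mean; there
  any point of [0,1] serves, and 0 is taken.\<close>

lemma occupancy_barycentre:
  assumes \<mu>: "occupancy_measure \<mu>"
  obtains c where "0 \<le> c" "c \<le> 1" "(\<integral>a. a \<partial>\<mu>) = measure \<mu> (space \<mu>) * c"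
proof -
  interpret finite_measure \<mu> using \<mu> by (simp add: occupancy_measure_def)
  let ?D = "measure \<mu> (space \<mu>)" and ?m = "\<integral>a. a \<partial>\<mu>"
  have m0: "0 \<le> ?m"
    by (intro integral_nonneg_AE AE_I2) (simp add: space_occupancy[OF \<mu>])
  have "?m \<le> (\<integral>a. 1 \<partial>\<mu>)"
    by (intro integral_mono occupancy_integrable_id[OF \<mu>]) (auto simp: space_occupancy[OF \<mu>])
  then have m1: "?m \<le> ?D" by simp
  show thesis
  proof (cases "?D = 0")
    case True
    then show thesis using m0 m1 that[of 0] by simp
  next
    case False
    then have "0 < ?D" using measure_nonneg[of \<mu> "space \<mu>"] by linarith
    then show thesis using m0 m1 that[of "?m / ?D"] by (simp add: divide_simps)
  qed
qed

text \<open>Jensen's inequality, obtained by integrating the tangent line at \<open>c\<close>; the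
  endpoints are handled by concentration.\<close>

lemma integral_binary_entropy_le:
  assumes \<mu>: "occupancy_measure \<mu>" and c: "0 \<le> c" "c \<le> 1"
    and m: "(\<integral>a. a \<partial>\<mu>) = measure \<mu> (space \<mu>) * c"
  shows "(\<integral>a. binary_entropy a \<partial>\<mu>) \<le> measure \<mu> (space \<mu>) * binary_entropy c"
proof (cases "c = 0 \<or> c = 1")
  case True
  then show ?thesis
    using integral_binary_entropy_boundary[OF \<mu> True m] by (auto simp: binary_entropy_def)
next
  case False
  with c have c': "0 < c" "c < 1" by auto
  interpret finite_measure \<mu> using \<mu> by (simp add: occupancy_measure_def)
  note id = occupancy_integrable_id[OF \<mu>]
  have "(\<integral>a. binary_entropy a \<partial>\<mu>) \<le> (\<integral>a. (ln (1 - c) - ln c) * a - ln (1 - c) \<partial>\<mu>)"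
  proof (rule integral_mono)
    show "integrable \<mu> (\<lambda>a. (ln (1 - c) - ln c) * a - ln (1 - c))" using id by simp
    show "binary_entropy a \<le> (ln (1 - c) - ln c) * a - ln (1 - c)" if "a \<in> space \<mu>" for a
      using binary_entropy_le_cross_entropy[of a c] that c'
      by (simp add: space_occupancy[OF \<mu>] algebra_simps)
  qed (rule occupancy_integrable_binary_entropy[OF \<mu>])
  \<comment> \<open>An affine function integrates to the mass times its value at the barycentre, and
    the tangent meets the entropy there.\<close>
  also have "\<dots> = measure \<mu> (space \<mu>) * binary_entropy c"
    using id m by (simp add: binary_entropy_def algebra_simps)
  finally show ?thesis .
qed

text \<open>For this cost Jensen's inequality is the triangle inequality for integrals, applied to
  \<open>a - p\<close>.\<close>

lemma TV_le_integral_TV: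
  assumes \<mu>: "occupancy_measure \<mu>"
    and m: "(\<integral>a. a \<partial>\<mu>) = measure \<mu> (space \<mu>) * c"
  shows "measure \<mu> (space \<mu>) * TV p c \<le> (\<integral>a. TV p a \<partial>\<mu>)"
proof -
  interpret finite_measure \<mu> using \<mu> by (simp add: occupancy_measure_def)
  have "(\<integral>a. a - p \<partial>\<mu>) = measure \<mu> (space \<mu>) * (c - p)"
    using occupancy_integrable_id[OF \<mu>] m by (simp add: algebra_simps)
  then have "measure \<mu> (space \<mu>) * \<bar>c - p\<bar> \<le> (\<integral>a. \<bar>a - p\<bar> \<partial>\<mu>)"
    using integral_abs_bound[of \<mu> "\<lambda>a. a - p"] by (simp add: abs_mult)
  then show ?thesis by (simp add: TV_eq)
qed

lemma P2_dominates_P1: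
  assumes \<gamma>: "\<gamma> < 1" and \<nu>: "\<nu>0 + \<nu>1 = 1"
    and feas: "P1_feasible \<gamma> \<nu>0 \<nu>1 p0 p1 b x"
  shows "\<exists>y. P2_feasible \<gamma> \<nu>0 p0 p1 b y \<and> P1_objective x \<le> P2_objective y"
proof -
  obtain \<mu>0 \<mu>1 where x: "x = (\<mu>0, \<mu>1)" by fastforce
  let ?D0 = "measure \<mu>0 (space \<mu>0)" and ?D1 = "measure \<mu>1 (space \<mu>1)"
  have o: "occupancy_measure \<mu>0" "occupancy_measure \<mu>1"
    using feas by (auto simp: P1_feasible_def x)
  interpret M0: finite_measure \<mu>0 using o by (simp add: occupancy_measure_def)
  interpret M1: finite_measure \<mu>1 using o by (simp add: occupancy_measure_def)
  obtain c0 where c0: "0 \<le> c0" "c0 \<le> 1" "(\<integral>a. a \<partial>\<mu>0) = ?D0 * c0"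
    using occupancy_barycentre[OF o(1)] .
  obtain c1 where c1: "0 \<le> c1" "c1 \<le> 1" "(\<integral>a. a \<partial>\<mu>1) = ?D1 * c1"
    using occupancy_barycentre[OF o(2)] .
  note id = occupancy_integrable_id[OF o(1)] occupancy_integrable_id[OF o(2)]
  have flow0: "?D0 - (\<gamma> * (?D0 * c0) + \<gamma> * (?D1 * c1)) = (1 - \<gamma>) * \<nu>0"
    using feas c0 c1 by (simp add: P1_feasible_def x)
  have flow1: "?D1 - (\<gamma> * (?D0 - ?D0 * c0) + \<gamma> * (?D1 - ?D1 * c1)) = (1 - \<gamma>) * \<nu>1"
    using feas c0 c1 id by (simp add: P1_feasible_def x)
  \<comment> \<open>Adding the flow constraints makes the barycentres cancel, because the
    probabilities of moving to state 0 and to state 1 sum to 1. Dividing by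
    \<open>1 - \<gamma>\<close>, which is positive, gives the normalisation of P2.\<close>
  have "(1 - \<gamma>) * (?D0 + ?D1) = (1 - \<gamma>) * (\<nu>0 + \<nu>1)"
    using flow0 flow1 by (simp add: algebra_simps)
  with \<gamma> \<nu> have mass: "?D0 + ?D1 = 1" by simp
  have "?D0 * TV p0 c0 + ?D1 * TV p1 c1 \<le> b"
    using TV_le_integral_TV[OF o(1) c0(3), of p0] TV_le_integral_TV[OF o(2) c1(3), of p1] feas
    by (simp add: P1_feasible_def x)
  then have "P2_feasible \<gamma> \<nu>0 p0 p1 b (c0, c1, ?D0, ?D1)"
    using flow0 mass c0 c1 by (simp add: P2_feasible_def algebra_simps)
  moreover have "P1_objective x \<le> P2_objective (c0, c1, ?D0, ?D1)"
    using integral_binary_entropy_le[OF o(1) c0] integral_binary_entropy_le[OF o(2) c1]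
    by (simp add: P1_objective_def P2_objective_def x)
  ultimately show ?thesis by blast
qed

text \<open>Reduces integrals against \<open>weighted_dirac\<close> to
  \<open>integral_density\<close> followed by \<open>integral_return\<close>.\<close>

lemma scale_measure_eq_density: "scale_measure r M = density M (\<lambda>_. r)"
  by (rule measure_eqI) (simp_all add: emeasure_density nn_integral_cmult)

lemma integral_weighted_dirac:
  fixes f :: "real \<Rightarrow> real"
  assumes "0 \<le> w" "0 \<le> a" "a \<le> 1" and f: "f \<in> borel_measurable borel"
  shows "(\<integral>x. f x \<partial>weighted_dirac w a) = w * f a"
proof -
  have "f \<in> borel_measurable unit_borel"
    using f by (rule measurable_restrict_space1)
  then show ?thesis
    using assms unfolding weighted_dirac_def scale_measure_eq_density
    by (subst integral_density) (auto simp: integral_return space_restrict_space)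
qed

lemma occupancy_measure_weighted_dirac:
  assumes "0 \<le> a" "a \<le> 1"
  shows "occupancy_measure (weighted_dirac w a)"
  using assms unfolding occupancy_measure_def weighted_dirac_def
  by (auto intro!: finite_measureI simp: space_scale_measure ennreal_mult_eq_top_iff
      space_restrict_space sets_restrict_space_iff)

definition P1_of_P2 :: "real \<times> real \<times> real \<times> real \<Rightarrow> real measure \<times> real measure" where
  "P1_of_P2 = (\<lambda>(a0, a1, d0, d1). (weighted_dirac d0 a0, weighted_dirac d1 a1))"

lemma P1_of_P2:
  assumes feas: "P2_feasible \<gamma> \<nu>0 p0 p1 b y" and \<nu>: "\<nu>0 + \<nu>1 = 1"
  shows "P1_feasible \<gamma> \<nu>0 \<nu>1 p0 p1 b (P1_of_P2 y)" "P1_objective (P1_of_P2 y) = P2_objective y"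
proof -
  obtain a0 a1 d0 d1 where y: "y = (a0, a1, d0, d1)" by (cases y)
  have r: "0 \<le> d0" "0 \<le> d1" "0 \<le> a0" "a0 \<le> 1" "0 \<le> a1" "a1 \<le> 1"
    and flow: "(1 - \<gamma> * a0) * d0 - \<gamma> * a1 * d1 = (1 - \<gamma>) * \<nu>0"
    and mass: "d0 + d1 = 1" and cost: "d0 * TV p0 a0 + d1 * TV p1 a1 \<le> b"
    using feas by (auto simp: P2_feasible_def y)
  have meas: "TV p \<in> borel_measurable borel" "binary_entropy \<in> borel_measurable borel" for p
    unfolding TV_def binary_entropy_def by measurable
  note int0 = integral_weighted_dirac[OF r(1,3,4)] and int1 = integral_weighted_dirac[OF r(2,5,6)]
  have d1: "d1 = 1 - d0" and \<nu>1: "\<nu>1 = 1 - \<nu>0" using mass \<nu> by auto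
  \<comment> \<open>P2 states only the flow into state 0. The flow into state 1 is its complement,
    by the total masses of the occupancy and of the initial distribution.\<close>
  have flow1: "d1 - (d0 * (\<gamma> * (1 - a0)) + d1 * (\<gamma> * (1 - a1))) = (1 - \<gamma>) * \<nu>1"
    using flow unfolding d1 \<nu>1 by (simp add: algebra_simps)
  show "P1_feasible \<gamma> \<nu>0 \<nu>1 p0 p1 b (P1_of_P2 y)"
    unfolding P1_feasible_def P1_of_P2_def y prod.case
    using flow flow1 cost
    \<comment> \<open>With \<open>lebesgue_integral_const\<close> removed, the integral of 1 is also
      evaluated by \<open>int0\<close> and \<open>int1\<close>, giving the weight itself rather than
      the measure of the whole space.\<close>
    by (simp add: int0 int1 meas occupancy_measure_weighted_dirac r del: lebesgue_integral_const)
      (simp add: algebra_simps)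
  show "P1_objective (P1_of_P2 y) = P2_objective y"
    by (simp add: P1_objective_def P2_objective_def P1_of_P2_def y int0 int1 meas)
qed

theorem theorem1:
  fixes \<gamma> p0 p1 b \<nu>0 \<nu>1 :: real
  assumes "0 \<le> \<gamma>" and "\<gamma> < 1"
    and "0 \<le> p0" and "p0 \<le> 1" and "0 \<le> p1" and "p1 \<le> 1"
    and "0 \<le> \<nu>0" and "0 \<le> \<nu>1" and "\<nu>0 + \<nu>1 = 1"
  shows "optimal_value P1_objective (P1_feasible \<gamma> \<nu>0 \<nu>1 p0 p1 b)
           = optimal_value P2_objective (P2_feasible \<gamma> \<nu>0 p0 p1 b)
    \<and> (\<forall>a0 a1 d0 d1.
          is_arg_max P2_objective (P2_feasible \<gamma> \<nu>0 p0 p1 b) (a0, a1, d0, d1) \<longrightarrow>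
          is_arg_max P1_objective (P1_feasible \<gamma> \<nu>0 \<nu>1 p0 p1 b)
            (weighted_dirac d0 a0, weighted_dirac d1 a1))"
proof (intro conjI allI impI)
  let ?P1 = "P1_feasible \<gamma> \<nu>0 \<nu>1 p0 p1 b" and ?P2 = "P2_feasible \<gamma> \<nu>0 p0 p1 b"
  note dom = P2_dominates_P1[OF assms(2,9), of p0 p1 b]
  note emb = P1_of_P2[of \<gamma> \<nu>0 p0 p1 b, OF _ assms(9)]
  show "optimal_value P1_objective ?P1 = optimal_value P2_objective ?P2"
    unfolding optimal_value_def
  \<comment> \<open>Each point on one side is matched by a point on the other side with at least the
    same objective, so the argument also covers empty feasible sets.\<close>
  proof (rule antisym)
    show "(SUP x\<in>{x. ?P1 x}. ereal (P1_objective x)) \<le> (SUP y\<in>{y. ?P2 y}. ereal (P2_objective y))"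
      using dom by (intro SUP_mono) fastforce
    show "(SUP y\<in>{y. ?P2 y}. ereal (P2_objective y)) \<le> (SUP x\<in>{x. ?P1 x}. ereal (P1_objective x))"
      by (intro SUP_mono) (metis emb mem_Collect_eq order_refl)
  qed
  fix a0 a1 d0 d1
  assume opt: "is_arg_max P2_objective ?P2 (a0, a1, d0, d1)"
  let ?y = "(a0, a1, d0, d1)"
  have max: "P2_objective z \<le> P2_objective ?y" if "?P2 z" for z
    using opt that unfolding is_arg_max_linorder by blast
  have y: "?P2 ?y" using opt by (simp add: is_arg_max_def)
  \<comment> \<open>Chain: \<open>x\<close> is dominated by some point of P2, that point by the
    optimum \<open>?y\<close>, and the embedding preserves the objective of
    \<open>?y\<close>.\<close>
  have "P1_objective x \<le> P1_objective (P1_of_P2 ?y)" if "?P1 x" for x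
    using dom[OF that] max emb(2)[OF y] by (metis order_trans)
  then have "is_arg_max P1_objective ?P1 (P1_of_P2 ?y)"
    using emb(1)[OF y] by (simp add: is_arg_max_linorder)
  then show "is_arg_max P1_objective ?P1 (weighted_dirac d0 a0, weighted_dirac d1 a1)"
    by (simp add: P1_of_P2_def)
qed

end
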